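(* For every finite poset $P$, $$\operatorname{gap}(P)=\sum_{q\in P}(d(q)-1)(r(q)-1)=\sum_{q\in \operatorname{St}(P)}w(q).$$
   Context: All posets are finite. Let $P$ be a poset with $n=|P|$ elements. The order polytope $\mathcal O(P)\subset\mathbb R^P$ is the set of $x\in[0,1]^P$ with $x_p\le x_q$ whenever $p\le q$ in $P$. The chain polytope $\mathcal C(P)\subset\mathbb R^P$ is the set of $x\in\mathbb R^P$ with $x_p\ge 0$ for all $p\in P$ and $x_{p_1}+\dots+x_{p_k}\le 1$ for every chain $p_1<\dots<p_k$ in $P$. Both are $n$-dimensional; $f_{n-1}$ denotes the number of facets, and $$\operatorname{gap}(P)=f_{n-1}(\mathcal C(P))-f_{n-1}(\mathcal O(P)).$$ Let $\widehat P=P\sqcup\{\widehat 0,\widehat 1\}$ be obtained from $P$ by adjoining a new smallest element $\widehat 0$ and a new largest element $\widehat 1$. Write $q\lessdot x$ if $x$ covers $q$ in $\widehat P$. For $q\in P$ let $d(q)$ be the number of maximal (i.e. saturated) chains in $\widehat P$ from $\widehat 0$ to $q$, and let $r(q)=\#\{x\in\widehat P: q\lessdot x\}$. Put $w(q)=(d(q)-1)(r(q)-1)$. An element $q\in P$ is a star element if $d(q)\ge 2$ and $r(q)\ge 2$; $\operatorname{St}(P)$ is the set of star elements of $P$. *)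

theory Defs
  imports "HOL-Analysis.Analysis" "HOL-Library.Extended"
begin

text \<open>
  A finite poset is a subset \<open>P\<close> of a finite ordered type \<open>'a\<close> with the induced order. Compared
  with always taking \<open>P = UNIV\<close> this also covers the empty poset. The space of real vectors indexed
  by \<open>P\<close> is identified with the coordinate subspace of \<open>real ^ 'a\<close> of the vectors vanishing
  outside \<open>P\<close> (the whole space if \<open>P = UNIV\<close>); facets do not depend on the ambient space.
\<close>

definition coord_space :: "'a::finite set \<Rightarrow> (real ^ 'a) set" where
  "coord_space P = {x. \<forall>p. p \<notin> P \<longrightarrow> x $ p = 0}"

definition order_polytope :: "'a::{finite,order} set \<Rightarrow> (real, 'a) vec set" where
  "order_polytope P =
     {x \<in> coord_space P. (\<forall>p\<in>P. 0 \<le> x $ p \<and> x $ p \<le> 1) \<and>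
                         (\<forall>p\<in>P. \<forall>q\<in>P. p \<le> q \<longrightarrow> x $ p \<le> x $ q)}"

text \<open>
  \<open>pred_on.chain A (<) C\<close> says that \<open>C\<close> is a totally ordered subset of \<open>A\<close>. It allows \<open>C = {}\<close>,
  for which the inequality below is void.
\<close>

definition chain_polytope :: "'a::{finite,order} set \<Rightarrow> (real, 'a) vec set" where
  "chain_polytope P =
     {x \<in> coord_space P. (\<forall>p\<in>P. 0 \<le> x $ p) \<and>
                         (\<forall>C. pred_on.chain P (<) C \<longrightarrow> (\<Sum>p\<in>C. x $ p) \<le> 1)}"

definition num_facets :: "'n::euclidean_space set \<Rightarrow> nat" where
  "num_facets S = card {F. F facet_of S}"

definition gap :: "'a::{finite,order} set \<Rightarrow> int" where
  "gap P = int (num_facets (chain_polytope P)) - int (num_facets (order_polytope P))"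

text \<open>
  In the ordered type \<open>'a extended\<close>, \<open>Minf\<close> lies below and \<open>Pinf\<close> above all the \<open>Fin p\<close>.
\<close>

definition hat :: "'a set \<Rightarrow> 'a extended set" where
  "hat P = insert Minf (insert Pinf (Fin ` P))"

definition covered_in :: "'b::order set \<Rightarrow> 'b \<Rightarrow> 'b \<Rightarrow> bool" where
  "covered_in Q a b \<longleftrightarrow> a \<in> Q \<and> b \<in> Q \<and> a < b \<and> \<not> (\<exists>z\<in>Q. a < z \<and> z < b)"

text \<open>
  The maximal chains of \<open>Q\<close> from \<open>a\<close> to \<open>b\<close>, as sets: the inclusion-maximal chains of the closed
  interval from \<open>a\<close> to \<open>b\<close> in \<open>Q\<close>.
\<close>

definition max_chains_between :: "'b::order set \<Rightarrow> 'b \<Rightarrow> 'b \<Rightarrow> 'b set set" where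
  "max_chains_between Q a b = {C. pred_on.maxchain {z \<in> Q. a \<le> z \<and> z \<le> b} (<) C}"

definition down_chains :: "'a::order set \<Rightarrow> 'a \<Rightarrow> nat" where
  "down_chains P q = card (max_chains_between (hat P) Minf (Fin q))"

definition up_degree :: "'a::order set \<Rightarrow> 'a \<Rightarrow> nat" where
  "up_degree P q = card {x \<in> hat P. covered_in (hat P) (Fin q) x}"

definition weight :: "'a::order set \<Rightarrow> 'a \<Rightarrow> int" where
  "weight P q = (int (down_chains P q) - 1) * (int (up_degree P q) - 1)"

definition star_elements :: "'a::order set \<Rightarrow> 'a set" where
  "star_elements P = {q \<in> P. down_chains P q \<ge> 2 \<and> up_degree P q \<ge> 2}"

end

theory Submission
  imports Defs
begin

text \<open>
  Let \<open>P\<close> be nonempty. The covering relations of \<open>hat P\<close> form an irredundant system of inequalities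
  for the order polytope, and the nonnegativity constraints together with the maximal chains of \<open>P\<close>
  form one for the chain polytope. Irredundant inequalities of a full-dimensional polyhedron
  correspond to its facets, so the gap is \<open>n + d(1) - #covers\<close>, where \<open>d(1)\<close> is the number of
  maximal chains of \<open>hat P\<close>.
  Removing the top element of a chain gives \<open>d(x) = (\<Sum>q. d(q))\<close> over the elements \<open>q\<close> covered by
  \<open>x\<close>. Summing over all \<open>x \<noteq> Minf\<close> and exchanging the summation over covers yields
  \<open>r(Minf) + (\<Sum>q\<in>P. d(q) r(q)) = d(1) + (\<Sum>q\<in>P. d(q))\<close>, from which the formula follows by
  expanding the product.
\<close>

section \<open>Facets of a polyhedron given by irredundant inequalities\<close>

lemma num_facets_irredundant:
  fixes L :: "'n::euclidean_space set" and a :: "'i \<Rightarrow> 'n"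
  assumes L: "affine L" and fin: "finite I"
    and z: "z \<in> L" "\<And>i. i \<in> I \<Longrightarrow> a i \<bullet> z < b i"
    and y: "\<And>i. i \<in> I \<Longrightarrow> y i \<in> L" "\<And>i. i \<in> I \<Longrightarrow> b i < a i \<bullet> y i"
      "\<And>i j. i \<in> I \<Longrightarrow> j \<in> I \<Longrightarrow> j \<noteq> i \<Longrightarrow> a j \<bullet> y i \<le> b j"
  shows "num_facets {x \<in> L. \<forall>i\<in>I. a i \<bullet> x \<le> b i} = card I"
proof -
  define S where "S = {x \<in> L. \<forall>i\<in>I. a i \<bullet> x \<le> b i}"
  define H where "H i = {x. a i \<bullet> x \<le> b i}" for i
  define T where "T = (\<Inter>i\<in>I. {x. a i \<bullet> x < b i})"
  \<comment> \<open>The explicit description of facets is indexed by half-spaces rather than by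
    labels. \<open>g\<close> recovers the label, which is possible because the points
    \<open>y i\<close> separate the half-spaces.\<close>
  define g where "g = inv_into I H"
  \<comment> \<open>\<open>L \<inter> T\<close> is nonempty and relatively open in \<open>L\<close>,
    hence spans \<open>L\<close>.\<close>
  have "open T"
    unfolding T_def using fin by (intro open_INT ballI open_halfspace_lt) auto
  moreover have "z \<in> L \<inter> T"
    using z by (auto simp: T_def)
  ultimately have "affine hull (L \<inter> T) = L"
    using affine_hull_affine_Int_open[of L T] L by (metis affine_hull_eq empty_iff)
  moreover have "L \<inter> T \<subseteq> S"
    by (auto simp: S_def T_def less_imp_le)
  ultimately have hull: "affine hull S = L"
    by (metis (no_types, lifting) L S_def hull_minimal hull_mono mem_Collect_eq subsetI subset_antisym)
  have inj: "inj_on H I"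
  proof (rule inj_onI, rule ccontr)
    fix i j assume "i \<in> I" "j \<in> I" "H i = H j" "i \<noteq> j"
    have "y i \<in> H j" "y i \<notin> H i"
      using y(2)[of i] y(3)[of i j] \<open>i \<in> I\<close> \<open>j \<in> I\<close> \<open>i \<noteq> j\<close> by (auto simp: H_def)
    with \<open>H i = H j\<close> show False by simp
  qed
  have S_eq: "S = L \<inter> \<Inter>(H ` I)"
    by (auto simp: S_def H_def)
  have nz: "a i \<noteq> 0" if "i \<in> I" for i
    using z(2)[OF that] y(2)[OF that] by auto
  have g: "g (H i) = i" if "i \<in> I" for i
    unfolding g_def using inj that by (rule inv_into_f_f)
  have facets: "C facet_of S \<longleftrightarrow> (\<exists>h. h \<in> H ` I \<and> C = S \<inter> {x. a (g h) \<bullet> x = b (g h)})" for C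
  proof (rule facet_of_polyhedron_explicit)
    show "finite (H ` I)" using fin by simp
    show "S = affine hull S \<inter> \<Inter>(H ` I)" unfolding hull by (rule S_eq)
    show "a (g h) \<noteq> 0 \<and> h = {x. a (g h) \<bullet> x \<le> b (g h)}" if "h \<in> H ` I" for h
    proof -
      from that obtain i where i: "i \<in> I" "h = H i" by blast
      then have "g h = i" using g by simp
      with i nz show ?thesis by (simp add: H_def)
    qed
    show "S \<subset> affine hull S \<inter> \<Inter>F'" if "F' \<subset> H ` I" for F'
    proof -
      from that obtain h where "h \<in> H ` I" "h \<notin> F'" by blast
      then obtain i where i: "i \<in> I" "H i \<notin> F'" by blast
      have "y i \<in> \<Inter>F'"
      proof
        fix h assume "h \<in> F'"
        then have "h \<in> H ` I" "h \<noteq> H i" using that i by auto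
        then obtain j where "j \<in> I" "h = H j" "j \<noteq> i" by blast
        then show "y i \<in> h" using y(3)[OF i(1)] by (simp add: H_def)
      qed
      moreover have "y i \<notin> S"
        using y(2)[OF i(1)] i(1) by (force simp: S_def)
      moreover have "S \<subseteq> L \<inter> \<Inter>F'"
        using that S_eq by blast
      ultimately show ?thesis
        using y(1)[OF i(1)] unfolding hull by blast
    qed
  qed
  define K where "K i = S \<inter> {x. a i \<bullet> x = b i}" for i
  have "{C. C facet_of S} = K ` I"
    using facets g by (auto simp: K_def)
  moreover have "inj_on K I"
  proof (rule inj_onI, rule ccontr)
    fix i j assume ij: "i \<in> I" "j \<in> I" "K i = K j" "i \<noteq> j"
    \<comment> \<open>The point where the segment from \<open>z\<close> to \<open>y i\<close> leaves \<open>S\<close> lies on the \<open>i\<close>-th facet only.\<close>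
    define t where "t = (b i - a i \<bullet> z) / (a i \<bullet> y i - a i \<bullet> z)"
    define w where "w = (1 - t) *\<^sub>R z + t *\<^sub>R y i"
    have t: "0 < t" "t < 1"
      using z(2)[OF ij(1)] y(2)[OF ij(1)] by (auto simp: t_def divide_simps)
    have wL: "w \<in> L"
      unfolding w_def using L z(1) y(1)[OF ij(1)] by (simp add: mem_affine)
    have "a i \<bullet> w = a i \<bullet> z + t * (a i \<bullet> y i - a i \<bullet> z)"
      by (simp add: w_def algebra_simps)
    also have "\<dots> = b i"
      using z(2)[OF ij(1)] y(2)[OF ij(1)] by (simp add: t_def)
    finally have wi: "a i \<bullet> w = b i" .
    have wk: "a k \<bullet> w < b k" if "k \<in> I" "k \<noteq> i" for k
    proof -
      have "(1 - t) * (a k \<bullet> z) < (1 - t) * b k"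
        using t z(2)[OF that(1)] by simp
      moreover have "t * (a k \<bullet> y i) \<le> t * b k"
        using t y(3)[OF ij(1) that] by simp
      ultimately show ?thesis by (simp add: w_def algebra_simps)
    qed
    have "w \<in> S"
      using wL wi wk by (force simp: S_def)
    then have "w \<in> K i" "w \<notin> K j"
      using wi wk[OF ij(2)] ij(4) by (auto simp: K_def)
    with ij(3) show False by simp
  qed
  ultimately show ?thesis
    unfolding num_facets_def S_def[symmetric] by (simp add: card_image)
qed

section \<open>Maximal chains of a poset and between two elements\<close>

lemma chain_iff:
  fixes A :: "'b::order set"
  shows "pred_on.chain A (<) C \<longleftrightarrow> C \<subseteq> A \<and> (\<forall>x\<in>C. \<forall>y\<in>C. x \<le> y \<or> y \<le> x)"
  unfolding pred_on.chain_def by (auto simp: le_less)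

text \<open>Maximality only has to be tested against extensions by one element, since any element of
  a larger chain outside \<open>C\<close> is already comparable with all of
  \<open>C\<close>.\<close>

lemma maxchain_iff:
  fixes A :: "'b::order set"
  shows "pred_on.maxchain A (<) C \<longleftrightarrow> C \<subseteq> A \<and> (\<forall>x\<in>C. \<forall>y\<in>C. x \<le> y \<or> y \<le> x)
           \<and> (\<forall>z\<in>A. (\<forall>x\<in>C. x \<le> z \<or> z \<le> x) \<longrightarrow> z \<in> C)"
    (is "?L \<longleftrightarrow> ?R")
proof
  assume L: ?L
  then have c: "C \<subseteq> A" "\<forall>x\<in>C. \<forall>y\<in>C. x \<le> y \<or> y \<le> x"
    unfolding pred_on.maxchain_def chain_iff by auto
  have "z \<in> C" if "z \<in> A" "\<forall>x\<in>C. x \<le> z \<or> z \<le> x" for z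
  proof (rule ccontr)
    assume "z \<notin> C"
    moreover have "pred_on.chain A (<) (insert z C)"
      using c that unfolding chain_iff by auto
    ultimately show False
      using L unfolding pred_on.maxchain_def by blast
  qed
  with c show ?R by simp
next
  assume R: ?R
  have "\<not> C \<subset> D" if "pred_on.chain A (<) D" for D
  proof
    assume "C \<subset> D"
    then obtain z where z: "z \<in> D" "z \<notin> C" "C \<subseteq> D" by blast
    then have "z \<in> A" "\<forall>x\<in>C. x \<le> z \<or> z \<le> x"
      using that by (auto simp: chain_iff)
    with R z show False by simp
  qed
  moreover have "pred_on.chain A (<) C"
    using R by (simp add: chain_iff)
  ultimately show ?L
    unfolding pred_on.maxchain_def by blast
qed

lemma chain_extends_to_maxchain:
  fixes A :: "'b::order set"
  assumes "finite A" "pred_on.chain A (<) C"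
  obtains M where "pred_on.maxchain A (<) M" "C \<subseteq> M"
proof -
  have "finite {D. pred_on.chain A (<) D}"
    by (rule finite_subset[of _ "Pow A"]) (use assms in \<open>auto simp: chain_iff\<close>)
  from finite_has_maximal2[OF this, of C] assms(2) obtain M
    where "pred_on.chain A (<) M" "C \<subseteq> M" "\<forall>D. pred_on.chain A (<) D \<longrightarrow> M \<subseteq> D \<longrightarrow> M = D"
    by auto
  then show ?thesis
    using that[of M] by (simp add: pred_on.maxchain_def psubset_eq)
qed

lemma max_chains_between_iff:
  "C \<in> max_chains_between Q a b \<longleftrightarrow> C \<subseteq> {z \<in> Q. a \<le> z \<and> z \<le> b}
     \<and> (\<forall>x\<in>C. \<forall>y\<in>C. x \<le> y \<or> y \<le> x)
     \<and> (\<forall>z\<in>Q. a \<le> z \<longrightarrow> z \<le> b \<longrightarrow> (\<forall>x\<in>C. x \<le> z \<or> z \<le> x) \<longrightarrow> z \<in> C)"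
  unfolding max_chains_between_def by (auto simp: maxchain_iff)

lemma finite_max_chains_between:
  "finite Q \<Longrightarrow> finite (max_chains_between Q a b)"
  by (rule finite_subset[of _ "Pow Q"]) (auto simp: max_chains_between_iff)

lemma max_chains_between_nonempty:
  "finite Q \<Longrightarrow> max_chains_between Q a b \<noteq> {}"
  using chain_extends_to_maxchain[of "{z \<in> Q. a \<le> z \<and> z \<le> b}" "{}"]
  by (fastforce simp: max_chains_between_def chain_iff)

lemma max_chains_between_refl:
  "a \<in> Q \<Longrightarrow> max_chains_between Q a a = {{a}}"
  by (rule set_eqI) (auto simp: max_chains_between_iff dest: order.antisym)

lemma max_chains_between_top:
  "C \<in> max_chains_between Q a b \<Longrightarrow> b \<in> Q \<Longrightarrow> a \<le> b \<Longrightarrow> b \<in> C"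
  by (auto simp: max_chains_between_iff)

lemma max_chains_between_bot:
  "C \<in> max_chains_between Q a b \<Longrightarrow> a \<in> Q \<Longrightarrow> a \<le> b \<Longrightarrow> a \<in> C"
  by (auto simp: max_chains_between_iff)

section \<open>Counting maximal chains by their last cover\<close>

text \<open>An element comparable with \<open>q\<close> but not below it lies strictly above
  \<open>q\<close>. If it is also at most \<open>x\<close>, the cover leaves only \<open>x\<close>
  itself.\<close>

lemma insert_max_chains_between:
  assumes C: "C \<in> max_chains_between Q a q" and q: "covered_in Q q x" "a \<le> q"
  shows "insert x C \<in> max_chains_between Q a x"
proof -
  have qx: "q \<in> Q" "x \<in> Q" "q < x" and cov: "\<And>z. z \<in> Q \<Longrightarrow> q < z \<Longrightarrow> \<not> z < x"
    using q by (auto simp: covered_in_def)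
  have "q \<in> C"
    using max_chains_between_top[OF C] qx q by simp
  have "z \<in> insert x C"
    if z: "z \<in> Q" "a \<le> z" "z \<le> x" and comp: "\<forall>y\<in>insert x C. y \<le> z \<or> z \<le> y" for z
  proof (cases "z \<le> q")
    case True
    then show ?thesis using C z comp by (auto simp: max_chains_between_iff)
  next
    case False
    then have "q < z" using comp \<open>q \<in> C\<close> by (auto simp: le_less)
    then show ?thesis using cov z by (auto simp: le_less)
  qed
  moreover have "\<forall>y\<in>C. y \<le> x"
    using C qx by (fastforce simp: max_chains_between_iff)
  ultimately show ?thesis
    using C qx q(2) by (auto simp: max_chains_between_iff)
qed

text \<open>Take \<open>q\<close> to be the largest element of \<open>C - {x}\<close>. An element
  strictly between \<open>q\<close> and \<open>x\<close> would be comparable with all of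
  \<open>C\<close>, so it would belong to \<open>C\<close> and contradict the choice of
  \<open>q\<close>.\<close>

lemma max_chains_between_decompose:
  assumes fin: "finite Q" and a: "a \<in> Q" "x \<in> Q" "a < x" and C: "C \<in> max_chains_between Q a x"
  obtains q D where "covered_in Q q x" "a \<le> q" "D \<in> max_chains_between Q a q" "C = insert x D"
proof -
  have Csub: "C \<subseteq> {z \<in> Q. a \<le> z \<and> z \<le> x}" and Cch: "\<And>y z. y \<in> C \<Longrightarrow> z \<in> C \<Longrightarrow> y \<le> z \<or> z \<le> y"
    and Cmax: "\<And>z. z \<in> Q \<Longrightarrow> a \<le> z \<Longrightarrow> z \<le> x \<Longrightarrow> (\<And>y. y \<in> C \<Longrightarrow> y \<le> z \<or> z \<le> y) \<Longrightarrow> z \<in> C"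
    using C by (auto simp: max_chains_between_iff)
  have aC: "a \<in> C - {x}" and xC: "x \<in> C"
    using max_chains_between_top[OF C] max_chains_between_bot[OF C] a by auto
  have "finite (C - {x})"
    by (rule finite_subset[OF _ fin]) (use Csub in auto)
  from finite_has_maximal2[OF this aC] obtain q
    where q: "q \<in> C - {x}" "a \<le> q" and "\<forall>y\<in>C - {x}. q \<le> y \<longrightarrow> q = y" by blast
  then have qmax: "\<And>y. y \<in> C \<Longrightarrow> y \<noteq> x \<Longrightarrow> y \<le> q"
    using Cch by fastforce
  have qx: "q \<in> Q" "q < x"
    using q Csub by auto
  have "\<not> (\<exists>z\<in>Q. q < z \<and> z < x)"
  proof
    assume "\<exists>z\<in>Q. q < z \<and> z < x"
    then obtain z where z: "z \<in> Q" "q < z" "z < x" by blast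
    have "z \<in> C"
      by (rule Cmax) (use z q qmax in \<open>force+\<close>)
    then show False using qmax z by fastforce
  qed
  then have cov: "covered_in Q q x"
    using qx a by (simp add: covered_in_def)
  have D: "C - {x} \<in> max_chains_between Q a q"
    unfolding max_chains_between_iff
  proof (intro conjI ballI impI)
    show "C - {x} \<subseteq> {z \<in> Q. a \<le> z \<and> z \<le> q}" using Csub qmax by blast
    show "y \<le> z \<or> z \<le> y" if "y \<in> C - {x}" "z \<in> C - {x}" for y z using Cch that by blast
    show "z \<in> C - {x}" if "z \<in> Q" "a \<le> z" "z \<le> q" "\<forall>y\<in>C - {x}. y \<le> z \<or> z \<le> y" for z
    proof -
      have "z < x" using that(3) qx(2) by simp
      moreover have "z \<in> C"
        by (rule Cmax) (use that \<open>z < x\<close> in auto)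
      ultimately show ?thesis by auto
    qed
  qed
  have "C = insert x (C - {x})"
    using xC by blast
  from that[OF cov q(2) D this] show ?thesis .
qed

text \<open>The decomposition by the last cover is unique: \<open>q\<close> is the largest element
  of the chain without \<open>x\<close>. The union over all \<open>q\<close> is therefore
  disjoint.\<close>

lemma card_max_chains_between:
  assumes fin: "finite Q" and a: "a \<in> Q" "\<And>z. z \<in> Q \<Longrightarrow> a \<le> z" and x: "x \<in> Q" "x \<noteq> a"
  shows "card (max_chains_between Q a x) =
           (\<Sum>q\<in>{q \<in> Q. covered_in Q q x}. card (max_chains_between Q a q))"
proof -
  define M where "M = max_chains_between Q a"
  have M_top: "q \<in> C" "C \<subseteq> {..q}" if "C \<in> M q" "q \<in> Q" for C q
  proof -
    show "q \<in> C"
      using max_chains_between_top that a(2) unfolding M_def by blast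
    show "C \<subseteq> {..q}"
      using that(1) unfolding M_def max_chains_between_iff by blast
  qed
  have below: "q < x" if "covered_in Q q x" for q
    using that by (simp add: covered_in_def)
  have notin: "x \<notin> C" if "C \<in> M q" "q \<in> Q" "covered_in Q q x" for C q
    using M_top(2)[OF that(1,2)] below[OF that(3)] by auto
  have "M x = (\<Union>q\<in>{q \<in> Q. covered_in Q q x}. insert x ` M q)" (is "_ = (\<Union>q\<in>?I. _)")
  proof (intro equalityI subsetI)
    fix C assume "C \<in> M x"
    moreover have "a < x" using a(2) x by (simp add: less_le)
    ultimately obtain q D where "covered_in Q q x" "D \<in> M q" "C = insert x D"
      using max_chains_between_decompose[OF fin a(1) x(1)] unfolding M_def by metis
    then show "C \<in> (\<Union>q\<in>?I. insert x ` M q)" by (auto simp: covered_in_def)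
  next
    fix C assume "C \<in> (\<Union>q\<in>?I. insert x ` M q)"
    then show "C \<in> M x"
      using insert_max_chains_between a(2) unfolding M_def by blast
  qed
  also have "card \<dots> = (\<Sum>q\<in>?I. card (insert x ` M q))"
  proof (rule card_UN_disjoint)
    show "finite ?I" using fin by simp
    show "\<forall>q\<in>?I. finite (insert x ` M q)"
      using fin by (simp add: M_def finite_max_chains_between)
    show "\<forall>q\<in>?I. \<forall>r\<in>?I. q \<noteq> r \<longrightarrow> insert x ` M q \<inter> insert x ` M r = {}"
    proof (intro ballI impI, rule ccontr)
      fix q r assume qr: "q \<in> ?I" "r \<in> ?I" "q \<noteq> r" "insert x ` M q \<inter> insert x ` M r \<noteq> {}"
      then obtain C D where CD: "C \<in> M q" "D \<in> M r" "insert x C = insert x D" by blast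
      then have "C = D"
        using notin[of C q] notin[of D r] qr by (metis (no_types, lifting) insert_ident mem_Collect_eq)
      then have "r \<le> q" "q \<le> r"
        using M_top[of C q] M_top[of D r] CD qr(1,2) by auto
      with qr(3) show False by simp
    qed
  qed
  also have "\<dots> = (\<Sum>q\<in>?I. card (M q))"
  proof (intro sum.cong refl card_image inj_onI)
    fix q C D assume "q \<in> ?I" "C \<in> M q" "D \<in> M q" "insert x C = insert x D"
    then show "C = D"
      using notin[of C q] notin[of D q] by (metis (no_types, lifting) insert_ident mem_Collect_eq)
  qed
  finally show ?thesis by (simp add: M_def)
qed

text \<open>Double counting over the covering pairs \<open>(q, x)\<close>, each weighted by the
  number of maximal chains up to \<open>q\<close>.\<close>

lemma sum_max_chains_between_up:
  fixes Q :: "'b::order set"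
  assumes fin: "finite Q" and a: "a \<in> Q" "\<And>z. z \<in> Q \<Longrightarrow> a \<le> z"
  shows "(\<Sum>q\<in>Q. card (max_chains_between Q a q) * card {x \<in> Q. covered_in Q q x}) =
           (\<Sum>x\<in>Q - {a}. card (max_chains_between Q a x))"
proof -
  \<comment> \<open>The recursion fails at \<open>a\<close>: it covers nothing, yet there is one
    maximal chain from \<open>a\<close> to \<open>a\<close>. Hence \<open>a\<close> is left out on
    the right.\<close>
  have "{q \<in> Q. covered_in Q q a} = {}"
    using a(2) by (auto simp: covered_in_def dest: leD)
  have "(\<Sum>q\<in>Q. card (max_chains_between Q a q) * card {x \<in> Q. covered_in Q q x}) =
          (\<Sum>q\<in>Q. \<Sum>x\<in>{x \<in> Q. covered_in Q q x}. card (max_chains_between Q a q))"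
    by (simp add: mult.commute)
  also have "\<dots> = (\<Sum>x\<in>Q. \<Sum>q\<in>{q \<in> Q. covered_in Q q x}. card (max_chains_between Q a q))"
    by (rule sum.swap_restrict) (use fin in auto)
  also have "\<dots> = (\<Sum>x\<in>Q - {a}. \<Sum>q\<in>{q \<in> Q. covered_in Q q x}. card (max_chains_between Q a q))"
    unfolding sum.remove[OF fin a(1)] \<open>{q \<in> Q. covered_in Q q a} = {}\<close> by simp
  also have "\<dots> = (\<Sum>x\<in>Q - {a}. card (max_chains_between Q a x))"
    by (rule sum.cong) (use card_max_chains_between[OF fin a] in auto)
  finally show ?thesis .
qed

section \<open>Induction along covers and the poset \<open>hat P\<close>\<close>

text \<open>In a finite poset the order is generated by covers: for \<open>c < d\<close>, a maximal
  element \<open>e\<close> with \<open>c \<le> e < d\<close> is covered by \<open>d\<close> and has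
  fewer elements below it.\<close>

lemma covered_in_induct:
  assumes "finite Q" "c \<in> Q" "d \<in> Q" "c \<le> d"
    and refl: "R c" and step: "\<And>e f. e \<in> Q \<Longrightarrow> c \<le> e \<Longrightarrow> covered_in Q e f \<Longrightarrow> R e \<Longrightarrow> R f"
  shows "R d"
  using assms(3,4)
proof (induction "card {z \<in> Q. z < d}" arbitrary: d rule: less_induct)
  case less
  show ?case
  proof (cases "c = d")
    case True
    then show ?thesis using refl by simp
  next
    case False
    then have "c \<in> {z \<in> Q. c \<le> z \<and> z < d}"
      using less.prems \<open>c \<in> Q\<close> by simp
    with \<open>finite Q\<close> obtain e where e: "e \<in> Q" "c \<le> e" "e < d"
      and max: "\<forall>z\<in>{z \<in> Q. c \<le> z \<and> z < d}. e \<le> z \<longrightarrow> e = z"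
      using finite_has_maximal[of "{z \<in> Q. c \<le> z \<and> z < d}"] by auto
    have "covered_in Q e d"
      unfolding covered_in_def
    proof (intro conjI notI)
      assume "\<exists>z\<in>Q. e < z \<and> z < d"
      then obtain z where "z \<in> Q" "e < z" "z < d" by blast
      with max e show False
        by (metis (mono_tags, lifting) less_imp_le mem_Collect_eq order.trans order_less_irrefl)
    qed (use e less.prems in auto)
    moreover have "R e"
    proof (rule less.hyps)
      show "card {z \<in> Q. z < e} < card {z \<in> Q. z < d}"
        by (rule psubset_card_mono) (use \<open>finite Q\<close> e in auto)
    qed (use e in auto)
    ultimately show ?thesis using step e by blast
  qed
qed

lemma in_hat [simp]: "Minf \<in> hat P" "Pinf \<in> hat P" "Fin p \<in> hat P \<longleftrightarrow> p \<in> P"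
  by (auto simp: hat_def)

lemma finite_hat [simp]: "finite P \<Longrightarrow> finite (hat P)"
  by (simp add: hat_def)

lemma sum_hat:
  assumes "finite P"
  shows "(\<Sum>e\<in>hat P. f e) = f Minf + f Pinf + (\<Sum>p\<in>P. f (Fin p))"
proof -
  have "Minf \<notin> insert Pinf (Fin ` P)" "Pinf \<notin> Fin ` P"
    by auto
  then show ?thesis
    using assms by (simp add: hat_def sum.reindex inj_on_def add.assoc)
qed

text \<open>\<open>Minf\<close> and \<open>Pinf\<close> are comparable with everything, so every
  maximal chain contains both. Deleting them is inverse to applying \<open>hat\<close> to a maximal
  chain of \<open>P\<close>.\<close>

lemma card_max_chains_between_hat:
  fixes P :: "'a::order set"
  shows "card (max_chains_between (hat P) Minf Pinf) = card {C. pred_on.maxchain P (<) C}"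
proof -
  have "bij_betw hat {C. pred_on.maxchain P (<) C} (max_chains_between (hat P) Minf Pinf)"
  proof (rule bij_betwI')
    show "hat C = hat D \<longleftrightarrow> C = D" for C D :: "'a set"
      by (metis in_hat(3) subset_antisym subsetI)
  next
    fix C assume "C \<in> {C. pred_on.maxchain P (<) C}"
    then show "hat C \<in> max_chains_between (hat P) Minf Pinf"
      by (auto simp: maxchain_iff max_chains_between_iff hat_def)
  next
    fix D assume D: "D \<in> max_chains_between (hat P) Minf Pinf"
    define C where "C = {p. Fin p \<in> D}"
    have "D \<subseteq> hat P"
      using D by (simp add: max_chains_between_iff)
    moreover have "Minf \<in> D" "Pinf \<in> D"
      using max_chains_between_bot[OF D] max_chains_between_top[OF D] by auto
    ultimately have "D = hat C"
      by (auto simp: C_def hat_def)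
    moreover have "pred_on.maxchain P (<) C"
      unfolding maxchain_iff
    proof (intro conjI ballI impI)
      show "C \<subseteq> P" using \<open>D \<subseteq> hat P\<close> by (auto simp: C_def)
      show "p \<le> q \<or> q \<le> p" if "p \<in> C" "q \<in> C" for p q
      proof -
        have "Fin p \<le> Fin q \<or> Fin q \<le> Fin p"
          using D that unfolding C_def max_chains_between_iff by blast
        then show ?thesis by simp
      qed
      show "p \<in> C" if p: "p \<in> P" "\<forall>q\<in>C. q \<le> p \<or> p \<le> q" for p
      proof -
        have "\<forall>e\<in>D. e \<le> Fin p \<or> Fin p \<le> e"
          unfolding \<open>D = hat C\<close> using p by (auto simp: hat_def)
        then have "Fin p \<in> D"
          using D p(1) by (simp add: max_chains_between_iff)
        then show ?thesis by (simp add: C_def)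
      qed
    qed
    ultimately show "\<exists>C\<in>{C. pred_on.maxchain P (<) C}. D = hat C" by blast
  qed
  then show ?thesis by (simp add: bij_betw_same_card)
qed

section \<open>Facets of the chain polytope\<close>

lemma affine_coord_space: "affine (coord_space P)"
  by (auto simp: affine_def coord_space_def)

text \<open>Since coordinates are nonnegative, the inequality of a chain follows from that of a
  maximal chain containing it. For empty \<open>P\<close> the only maximal chain is empty; its
  inequality \<open>0 \<le> 1\<close> is never violated and defines no facet.\<close>

lemma num_facets_chain_polytope:
  fixes P :: "'a::{finite,order} set"
  assumes "P \<noteq> {}"
  shows "num_facets (chain_polytope P) = card P + card {C. pred_on.maxchain P (<) C}"
proof -
  define \<M> where "\<M> = {C. pred_on.maxchain P (<) C}"
  \<comment> \<open>\<open>Inl p\<close> labels the constraint \<open>- x $ p \<le> 0\<close>, and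
    \<open>Inr C\<close> the inequality of the maximal chain \<open>C\<close>.\<close>
  define a :: "'a + 'a set \<Rightarrow> (real, 'a) vec"
    where "a = case_sum (\<lambda>p. - axis p 1) (\<lambda>C. \<Sum>p\<in>C. axis p 1)"
  define b :: "'a + 'a set \<Rightarrow> real" where "b = case_sum (\<lambda>_. 0) (\<lambda>_. 1)"
  have a: "a (Inl p) \<bullet> x = - x $ p" "a (Inr C) \<bullet> x = (\<Sum>p\<in>C. x $ p)" for p C x
    by (simp_all add: a_def inner_axis' inner_sum_left)
  have b: "b (Inl p) = 0" "b (Inr C) = 1" for p C
    by (simp_all add: b_def)
  have sub: "C \<subseteq> P" if "C \<in> \<M>" for C
    using that by (simp add: \<M>_def maxchain_iff)
  have ne: "C \<noteq> {}" if "C \<in> \<M>" for C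
    using that assms by (auto simp: \<M>_def maxchain_iff)
  have eq: "chain_polytope P = {x \<in> coord_space P. \<forall>i\<in>P <+> \<M>. a i \<bullet> x \<le> b i}"
  proof (intro equalityI subsetI)
    fix x assume "x \<in> chain_polytope P"
    then show "x \<in> {x \<in> coord_space P. \<forall>i\<in>P <+> \<M>. a i \<bullet> x \<le> b i}"
      by (auto simp: chain_polytope_def a b \<M>_def pred_on.maxchain_def)
  next
    fix x assume "x \<in> {x \<in> coord_space P. \<forall>i\<in>P <+> \<M>. a i \<bullet> x \<le> b i}"
    then have x: "x \<in> coord_space P" "\<And>p. p \<in> P \<Longrightarrow> 0 \<le> x $ p"
      and M: "\<And>M. M \<in> \<M> \<Longrightarrow> (\<Sum>p\<in>M. x $ p) \<le> 1"
      by (simp_all add: a b Plus_def ball_Un)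
    have "(\<Sum>p\<in>C. x $ p) \<le> 1" if chain: "pred_on.chain P (<) C" for C
    proof -
      obtain M where "pred_on.maxchain P (<) M" "C \<subseteq> M"
        using chain_extends_to_maxchain[OF _ chain] by auto
      then have "M \<in> \<M>" by (simp add: \<M>_def)
      have "(\<Sum>p\<in>C. x $ p) \<le> (\<Sum>p\<in>M. x $ p)"
        using \<open>C \<subseteq> M\<close> sub[OF \<open>M \<in> \<M>\<close>] x(2) by (intro sum_mono2) auto
      with M[OF \<open>M \<in> \<M>\<close>] show ?thesis by simp
    qed
    with x show "x \<in> chain_polytope P" by (simp add: chain_polytope_def)
  qed
  \<comment> \<open>A chain has at most \<open>card P\<close> elements, so the denominator
    \<open>1 + card P\<close> keeps its sum strictly below 1.\<close>
  define z :: "(real, 'a) vec" where "z = (\<chi> p. if p \<in> P then 1 / (1 + real (card P)) else 0)"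
  \<comment> \<open>The constant on \<open>C\<close> lies strictly between \<open>1 / card C\<close> and, unless \<open>card C = 1\<close>,
    \<open>1 / (card C - 1)\<close>; other maximal chains miss an element of \<open>C\<close>.\<close>
  define yC :: "'a set \<Rightarrow> (real, 'a) vec"
    where "yC C = (\<chi> p. if p \<in> C then 2 / (2 * real (card C) - 1) else 0)" for C
  define y :: "'a + 'a set \<Rightarrow> (real, 'a) vec" where "y = case_sum (\<lambda>p. - axis p 1) yC"
  have sum_yC: "(\<Sum>p\<in>D. yC C $ p) = real (card (D \<inter> C)) * (2 / (2 * real (card C) - 1))" for C D
    by (simp add: yC_def flip: sum.inter_restrict)
  have card_pos: "1 \<le> card C" if "C \<in> \<M>" for C
    using ne[OF that] by (simp add: Suc_le_eq card_gt_0_iff)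
  have "num_facets (chain_polytope P) = card (P <+> \<M>)"
    unfolding eq
  proof (rule num_facets_irredundant[where z = z and y = y])
    show "affine (coord_space P)" by (rule affine_coord_space)
    show "finite (P <+> \<M>)" by simp
    show "z \<in> coord_space P" by (simp add: z_def coord_space_def)
    show "a i \<bullet> z < b i" if "i \<in> P <+> \<M>" for i
      using that
    proof (cases rule: PlusE[consumes 1, case_names Inl Inr])
      case (Inl p)
      then show ?thesis by (simp add: a b z_def add_pos_nonneg)
    next
      case (Inr C)
      have "(\<Sum>p\<in>C. z $ p) = real (card C) / (1 + real (card P))"
        using sub[OF Inr(1)] by (simp add: z_def subset_iff)
      also have "\<dots> < 1"
        using card_mono[OF _ sub[OF Inr(1)]] by simp
      finally show ?thesis using Inr by (simp add: a b)
    qed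
    show "y i \<in> coord_space P" if "i \<in> P <+> \<M>" for i
      using that by (auto simp: y_def yC_def coord_space_def axis_def dest!: sub)
    show "b i < a i \<bullet> y i" if "i \<in> P <+> \<M>" for i
      using that
    proof (cases rule: PlusE[consumes 1, case_names Inl Inr])
      case (Inl p)
      then show ?thesis by (simp add: a b y_def)
    next
      case (Inr C)
      then show ?thesis
        using card_pos[OF Inr(1)] by (simp add: a b y_def sum_yC divide_simps)
    qed
    show "a j \<bullet> y i \<le> b j" if i: "i \<in> P <+> \<M>" and j: "j \<in> P <+> \<M>" and "j \<noteq> i" for i j
      using i
    proof (cases rule: PlusE[consumes 1, case_names Inl Inr])
      case (Inl p)
      have "(\<Sum>q\<in>D. y i $ q) \<le> 0" for D
        by (rule sum_nonpos) (simp add: Inl y_def axis_def)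
      then have "(\<Sum>q\<in>D. y i $ q) \<le> 1" for D
        by (rule order.trans) simp
      with Inl j \<open>j \<noteq> i\<close> show ?thesis
        by (auto simp: a b) (auto simp: y_def axis_def split: if_splits)
    next
      case C: (Inr C)
      show ?thesis
        using j
      proof (cases rule: PlusE[consumes 1, case_names Inl Inr])
        case (Inl p)
        with C card_pos[OF C(1)] show ?thesis by (simp add: a b y_def yC_def)
      next
        case D: (Inr D)
        \<comment> \<open>Distinct maximal chains are not nested, so with \<open>c = card C\<close>
          the sum over \<open>D\<close> is at most \<open>2 * (c - 1) / (2 * c - 1)\<close>, which
          is below 1.\<close>
        have "\<not> C \<subset> D" "C \<noteq> D"
          using C D \<open>j \<noteq> i\<close> unfolding \<M>_def pred_on.maxchain_def by auto
        then have "card (D \<inter> C) < card C"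
          by (intro psubset_card_mono) auto
        then have "real (card (D \<inter> C)) + 1 \<le> real (card C)"
          by linarith
        with C D card_pos[OF C(1)] show ?thesis
          by (simp add: a b y_def sum_yC divide_simps)
      qed
    qed
  qed
  then show ?thesis
    by (simp add: card_Plus \<M>_def)
qed

section \<open>Facets of the order polytope\<close>

text \<open>With the boundary values 0 and 1, the bounds on the coordinates become monotonicity from
  \<open>Minf\<close> and to \<open>Pinf\<close>, so all constraints take one form.\<close>

definition hat_coord :: "(real, 'a) vec \<Rightarrow> 'a::finite extended \<Rightarrow> real" where
  "hat_coord x e = (case e of Minf \<Rightarrow> 0 | Fin p \<Rightarrow> x $ p | Pinf \<Rightarrow> 1)"

lemma hat_coord_simps [simp]:
  "hat_coord x Minf = 0" "hat_coord x (Fin p) = x $ p" "hat_coord x Pinf = 1"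
  by (simp_all add: hat_coord_def)

text \<open>Monotonicity on \<open>hat P\<close> propagates along covers, and it contains both the
  order relations of \<open>P\<close> and the bounds.\<close>

lemma order_polytope_iff_covers:
  fixes P :: "'a::{finite,order} set"
  shows "x \<in> order_polytope P \<longleftrightarrow>
    x \<in> coord_space P \<and> (\<forall>c d. covered_in (hat P) c d \<longrightarrow> hat_coord x c \<le> hat_coord x d)"
    (is "_ \<longleftrightarrow> ?C \<and> ?R")
proof
  assume x: "x \<in> order_polytope P"
  have "hat_coord x c \<le> hat_coord x d" if "covered_in (hat P) c d" for c d
  proof -
    have "c \<in> hat P" "d \<in> hat P" "c < d"
      using that by (auto simp: covered_in_def)
    then show ?thesis
      using x by (cases c; cases d) (auto simp: order_polytope_def less_imp_le)
  qed
  with x show "?C \<and> ?R" by (simp add: order_polytope_def)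
next
  assume CR: "?C \<and> ?R"
  have mono: "hat_coord x c \<le> hat_coord x d" if "c \<in> hat P" "d \<in> hat P" "c \<le> d" for c d
  proof (rule covered_in_induct[OF _ that, where R = "\<lambda>e. hat_coord x c \<le> hat_coord x e"])
    show "hat_coord x c \<le> hat_coord x f"
      if "covered_in (hat P) e f" "hat_coord x c \<le> hat_coord x e" for e f
      using CR that by (meson order.trans)
  qed auto
  have "0 \<le> x $ p \<and> x $ p \<le> 1" if "p \<in> P" for p
    using mono[of Minf "Fin p"] mono[of "Fin p" Pinf] that by simp
  moreover have "x $ p \<le> x $ q" if "p \<in> P" "q \<in> P" "p \<le> q" for p q
    using mono[of "Fin p" "Fin q"] that by simp
  ultimately show "x \<in> order_polytope P"
    using CR by (simp add: order_polytope_def)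
qed

text \<open>A function \<open>\<psi>\<close> that is larger at \<open>Pinf\<close> than at
  \<open>Minf\<close> can be normalized to the values 0 and 1 there by an increasing affine map.
  Comparisons between values survive, so witnesses can be built without fixing the boundary
  values.\<close>

lemma hat_coord_rescale:
  assumes "\<psi> Minf < \<psi> Pinf" "e \<in> hat P"
  shows "hat_coord (\<chi> p. if p \<in> P then (\<psi> (Fin p) - \<psi> Minf) / (\<psi> Pinf - \<psi> Minf) else 0) e =
           (\<psi> e - \<psi> Minf) / (\<psi> Pinf - \<psi> Minf)"
  using assms by (cases e) auto

text \<open>The right-hand side counts covering pairs, one facet for each. For empty
  \<open>P\<close> the only cover would be \<open>(Minf, Pinf)\<close>, whose inequality
  \<open>0 \<le> 1\<close> cannot be violated.\<close>

lemma num_facets_order_polytope: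
  fixes P :: "'a::{finite,order} set"
  assumes "P \<noteq> {}"
  shows "num_facets (order_polytope P) = (\<Sum>q\<in>hat P. card {x \<in> hat P. covered_in (hat P) q x})"
proof -
  define Q where "Q = hat P"
  have fin: "finite Q" by (simp add: Q_def)
  define I where "I = Sigma Q (\<lambda>q. {x \<in> Q. covered_in Q q x})"
  \<comment> \<open>\<open>v\<close> and \<open>k\<close> are the linear and the constant part of
    \<open>hat_coord x e\<close> as a function of \<open>x\<close>.\<close>
  define v :: "'a extended \<Rightarrow> (real, 'a) vec" where "v e = (case e of Fin p \<Rightarrow> axis p 1 | _ \<Rightarrow> 0)" for e
  define k :: "'a extended \<Rightarrow> real" where "k e = (case e of Pinf \<Rightarrow> 1 | _ \<Rightarrow> 0)" for e
  define a where "a = (\<lambda>(c, d). v c - v d)"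
  define b where "b = (\<lambda>(c, d). k d - k c)"
  have vk: "hat_coord x e = v e \<bullet> x + k e" for x e
    by (simp add: hat_coord_def v_def k_def inner_axis' split: extended.split)
  have le: "a (c, d) \<bullet> x \<le> b (c, d) \<longleftrightarrow> hat_coord x c \<le> hat_coord x d"
    and less: "a (c, d) \<bullet> x < b (c, d) \<longleftrightarrow> hat_coord x c < hat_coord x d"
    and greater: "b (c, d) < a (c, d) \<bullet> x \<longleftrightarrow> hat_coord x d < hat_coord x c" for c d x
    unfolding vk by (auto simp: a_def b_def inner_diff_left)
  have I: "(c, d) \<in> I \<longleftrightarrow> covered_in Q c d" for c d
    by (auto simp: I_def covered_in_def)
  have eq: "order_polytope P = {x \<in> coord_space P. \<forall>i\<in>I. a i \<bullet> x \<le> b i}"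
    by (simp add: set_eq_iff order_polytope_iff_covers Ball_def split_paired_All I le Q_def)
  define vec where "vec \<psi> = (\<chi> p. if p \<in> P then (\<psi> (Fin p) - \<psi> Minf) / (\<psi> Pinf - \<psi> Minf) else 0)"
    for \<psi> :: "'a extended \<Rightarrow> real"
  have vec_less: "hat_coord (vec \<psi>) c < hat_coord (vec \<psi>) d \<longleftrightarrow> \<psi> c < \<psi> d"
    if "\<psi> Minf < \<psi> Pinf" "c \<in> Q" "d \<in> Q" for \<psi> c d
    using that unfolding vec_def Q_def by (simp add: hat_coord_rescale divide_less_cancel)
  have vec_le: "hat_coord (vec \<psi>) c \<le> hat_coord (vec \<psi>) d \<longleftrightarrow> \<psi> c \<le> \<psi> d"
    if "\<psi> Minf < \<psi> Pinf" "c \<in> Q" "d \<in> Q" for \<psi> c d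
    using vec_less[OF that(1,3,2)] by (simp add: not_less[symmetric])
  have vec_coord: "vec \<psi> \<in> coord_space P" for \<psi>
    by (simp add: vec_def coord_space_def)
  \<comment> \<open>\<open>h\<close> is strictly increasing with values in \<open>[0, 1)\<close> on
    \<open>Q\<close>, so a jump of size 1 outweighs any difference of its values.\<close>
  define h where "h e = real (card {z \<in> Q. z < e}) / real (card Q)" for e
  have "card Q > 0"
    using fin by (auto simp: card_gt_0_iff Q_def hat_def)
  have h_less: "h c < h d" if "c \<in> Q" "c < d" for c d
  proof -
    have "card {z \<in> Q. z < c} < card {z \<in> Q. z < d}"
      by (rule psubset_card_mono) (use that fin in auto)
    then show ?thesis
      using \<open>card Q > 0\<close> by (simp add: h_def divide_strict_right_mono)
  qed
  have h_lt_1: "h e < 1" if "e \<in> Q" for e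
  proof -
    have "card {z \<in> Q. z < e} < card Q"
      by (rule psubset_card_mono) (use that fin in auto)
    then show ?thesis by (simp add: h_def)
  qed
  have h_nonneg: "0 \<le> h e" for e
    by (simp add: h_def)
  have h_Minf: "h Minf < h Pinf"
    by (rule h_less) (simp_all add: Q_def)
  \<comment> \<open>For a cover \<open>(c, d)\<close>, the indicator of \<open>{e. c \<le> e} - {d}\<close> decreases along the cover
    \<open>(c, d)\<close> only; adding \<open>h\<close> makes the total increase from \<open>Minf\<close> to \<open>Pinf\<close> positive.\<close>
  define \<psi> where "\<psi> = (\<lambda>(c, d) e. h e + (if c \<le> e \<and> e \<noteq> d then 1 else 0))"
  have not_cover: "\<not> covered_in Q Minf Pinf"
  proof -
    obtain p where "p \<in> P" using assms by blast
    then have "Fin p \<in> Q" "Minf < Fin p" "Fin p < Pinf" by (simp_all add: Q_def)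
    then show ?thesis unfolding covered_in_def by blast
  qed
  have \<psi>_Minf: "\<psi> (c, d) Minf < \<psi> (c, d) Pinf" if "covered_in Q c d" for c d
  proof -
    \<comment> \<open>The indicator could drop from \<open>Minf\<close> to \<open>Pinf\<close> only
      for \<open>c = Minf\<close> and \<open>d = Pinf\<close>, which is not a cover because
      \<open>P\<close> is nonempty.\<close>
    have "c \<noteq> Minf \<or> d \<noteq> Pinf" "d \<noteq> Minf"
      using not_cover that by (auto simp: covered_in_def)
    then show ?thesis
      using h_Minf h_lt_1[of Minf] h_nonneg[of Pinf] by (auto simp: \<psi>_def Q_def)
  qed
  have "num_facets (order_polytope P) = card I"
    unfolding eq
  proof (rule num_facets_irredundant[where z = "vec h" and y = "\<lambda>i. vec (\<psi> i)"])
    show "affine (coord_space P)" by (rule affine_coord_space)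
    show "finite I" using fin by (simp add: I_def)
    show "vec h \<in> coord_space P" by (rule vec_coord)
    show "vec (\<psi> i) \<in> coord_space P" for i by (rule vec_coord)
    show "a i \<bullet> vec h < b i" if "i \<in> I" for i
    proof -
      obtain c d where i: "i = (c, d)" by (cases i)
      with that have "c \<in> Q" "d \<in> Q" "c < d"
        by (auto simp: I covered_in_def)
      then show ?thesis
        unfolding i less using vec_less[OF h_Minf] h_less by simp
    qed
    show "b i < a i \<bullet> vec (\<psi> i)" if "i \<in> I" for i
    proof -
      obtain c d where i: "i = (c, d)" by (cases i)
      with that have cov: "covered_in Q c d" by (simp add: I)
      then have cd: "c \<in> Q" "d \<in> Q" "c < d" by (auto simp: covered_in_def)
      then have "\<psi> i d < \<psi> i c"
        using h_lt_1[of d] h_nonneg[of c] by (auto simp: \<psi>_def i)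
      then show ?thesis
        unfolding i greater using vec_less[OF \<psi>_Minf[OF cov]] cd by simp
    qed
    show "a j \<bullet> vec (\<psi> i) \<le> b j" if "i \<in> I" "j \<in> I" "j \<noteq> i" for i j
    proof -
      obtain c d e f where i: "i = (c, d)" and j: "j = (e, f)" by (cases i; cases j)
      with that have cov: "covered_in Q c d" and cov': "covered_in Q e f" and "\<not> (e = c \<and> f = d)"
        by (auto simp: I)
      then have ef: "e \<in> Q" "f \<in> Q" "e < f" by (auto simp: covered_in_def)
      \<comment> \<open>The indicator does not drop along another cover \<open>(e, f)\<close>: if
        \<open>f = d\<close>, then \<open>c \<le> e < d\<close> forces \<open>e = c\<close>, which
        is the same cover.\<close>
      have "c \<le> f \<and> f \<noteq> d" if "c \<le> e" "e \<noteq> d"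
      proof
        show "c \<le> f" using that ef by simp
        show "f \<noteq> d"
          using cov ef that \<open>\<not> (e = c \<and> f = d)\<close> by (auto simp: covered_in_def le_less)
      qed
      then have "\<psi> i e \<le> \<psi> i f"
        using h_less[OF ef(1,3)] by (auto simp: \<psi>_def i)
      then show ?thesis
        unfolding i j le using vec_le[OF \<psi>_Minf[OF cov] ef(1,2)] by simp
    qed
  qed
  also have "\<dots> = (\<Sum>q\<in>Q. card {x \<in> Q. covered_in Q q x})"
    unfolding I_def using fin by simp
  finally show ?thesis by (simp add: Q_def)
qed

section \<open>The gap formula and the star elements\<close>

text \<open>A facet is nonempty, so here it would be all of \<open>S\<close>, which is not a facet
  of itself. This settles the empty poset.\<close>

lemma num_facets_subset_singleton:
  assumes "S \<subseteq> {v}"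
  shows "num_facets S = 0"
proof -
  have "\<not> F facet_of S" for F
  proof
    assume F: "F facet_of S"
    then have "F \<noteq> {}" "F \<subseteq> S"
      by (auto simp: facet_of_def facet_of_imp_subset)
    with assms have "F = S" by blast
    with F show False by (simp add: facet_of_irrefl)
  qed
  then show ?thesis by (simp add: num_facets_def)
qed

lemma gap_eq_sum:
  fixes P :: "'a::{finite,order} set"
  shows "gap P = (\<Sum>q\<in>P. (int (down_chains P q) - 1) * (int (up_degree P q) - 1))"
proof (cases "P = {}")
  case True
  then have "chain_polytope P \<subseteq> {0}" "order_polytope P \<subseteq> {0}"
    by (auto simp: chain_polytope_def order_polytope_def coord_space_def vec_eq_iff)
  then show ?thesis using True by (simp add: gap_def num_facets_subset_singleton)
next
  case False
  define D where "D = (\<lambda>e. card (max_chains_between (hat P) Minf e))"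
  define r where "r = (\<lambda>e. card {x \<in> hat P. covered_in (hat P) e x})"
  have D_Minf: "D Minf = 1"
    by (simp add: D_def max_chains_between_refl)
  have r_Pinf: "r Pinf = 0"
    by (simp add: r_def covered_in_def)
  have "(\<Sum>e\<in>hat P. D e * r e) = (\<Sum>e\<in>hat P - {Minf}. D e)"
    unfolding D_def r_def by (rule sum_max_chains_between_up) auto
  moreover have "(\<Sum>e\<in>hat P. D e) = D Minf + (\<Sum>e\<in>hat P - {Minf}. D e)"
    by (rule sum.remove) auto
  \<comment> \<open>On the left \<open>Minf\<close> contributes \<open>r Minf\<close>, as
    \<open>D Minf = 1\<close>, and \<open>Pinf\<close> contributes nothing, as
    \<open>r Pinf = 0\<close>. On the right \<open>D Pinf\<close> splits off.\<close>
  ultimately have count: "r Minf + (\<Sum>p\<in>P. D (Fin p) * r (Fin p)) = D Pinf + (\<Sum>p\<in>P. D (Fin p))"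
    by (simp add: sum_hat D_Minf r_Pinf)
  have "num_facets (chain_polytope P) = card P + D Pinf"
    using num_facets_chain_polytope[OF False] by (simp add: D_def card_max_chains_between_hat)
  moreover have "num_facets (order_polytope P) = r Minf + (\<Sum>p\<in>P. r (Fin p))"
    using num_facets_order_polytope[OF False] r_Pinf by (simp add: sum_hat r_def)
  moreover have "(\<Sum>q\<in>P. (int (down_chains P q) - 1) * (int (up_degree P q) - 1)) =
      (\<Sum>p\<in>P. int (D (Fin p)) * int (r (Fin p))) - (\<Sum>p\<in>P. int (D (Fin p)))
      - (\<Sum>p\<in>P. int (r (Fin p))) + int (card P)"
    by (simp add: down_chains_def up_degree_def D_def r_def algebra_simps sum.distrib sum_subtractf)
  ultimately show ?thesis
    using arg_cong[OF count, of int] by (simp add: gap_def)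
qed

lemma down_chains_pos: "finite P \<Longrightarrow> 0 < down_chains P q"
  unfolding down_chains_def
  by (simp add: card_gt_0_iff finite_max_chains_between max_chains_between_nonempty)

text \<open>\<open>Pinf\<close> lies above \<open>Fin q\<close>, and a minimal element above
  \<open>Fin q\<close> covers it.\<close>

lemma up_degree_pos:
  assumes "finite P" "q \<in> P"
  shows "0 < up_degree P q"
proof -
  have "finite {x \<in> hat P. Fin q < x}" "Pinf \<in> {x \<in> hat P. Fin q < x}"
    using assms by simp_all
  then obtain x where x: "x \<in> hat P" "Fin q < x"
    and min: "\<forall>y\<in>{x \<in> hat P. Fin q < x}. y \<le> x \<longrightarrow> x = y"
    using finite_has_minimal2 by blast
  have "covered_in (hat P) (Fin q) x"
    using x min assms by (auto simp: covered_in_def)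
  then show ?thesis
    unfolding up_degree_def card_gt_0_iff using \<open>finite P\<close> x(1) by fastforce
qed

theorem theorem2p1:
  fixes P :: "'a::{finite,order} set"
  shows "gap P = (\<Sum>q\<in>P. (int (down_chains P q) - 1) * (int (up_degree P q) - 1)) \<and>
         (\<Sum>q\<in>P. (int (down_chains P q) - 1) * (int (up_degree P q) - 1)) =
           (\<Sum>q\<in>star_elements P. weight P q)"
proof
  show "gap P = (\<Sum>q\<in>P. (int (down_chains P q) - 1) * (int (up_degree P q) - 1))"
    by (rule gap_eq_sum)
  \<comment> \<open>Both counts are at least 1, so outside the star elements one of them equals 1
    and its factor vanishes.\<close>
  have "weight P q = 0" if "q \<in> P - star_elements P" for q
  proof -
    have "down_chains P q = 1 \<or> up_degree P q = 1"
      using that down_chains_pos[of P q] up_degree_pos[of P q] by (auto simp: star_elements_def)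
    then show ?thesis by (auto simp: weight_def)
  qed
  then have "(\<Sum>q\<in>P. weight P q) = (\<Sum>q\<in>star_elements P. weight P q)"
    by (intro sum.mono_neutral_right) (auto simp: star_elements_def)
  then show "(\<Sum>q\<in>P. (int (down_chains P q) - 1) * (int (up_degree P q) - 1)) =
      (\<Sum>q\<in>star_elements P. weight P q)"
    by (simp add: weight_def)
qed

end
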